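(* Let $a,b$ be nonzero real numbers and let $k$ be a positive odd integer. Then for every real $x$ with $(ax)^2\ge -4b$, \[ \sqrt[k]{\tfrac{\psi^{a,b}_{k}(x)}{2}+\sqrt{\tfrac{(\psi^{a,b}_{k}(x))^2}{4}+b^k}}+\sqrt[k]{\tfrac{\psi^{a,b}_{k}(x)}{2}-\sqrt{\tfrac{(\psi^{a,b}_{k}(x))^2}{4}+b^k}}=a x, \] and \[ \sqrt[k]{\tfrac{\psi^{a,b}_{k}(x)}{2}+\sqrt{\tfrac{(\psi^{a,b}_{k}(x))^2}{4}+b^k}}-\sqrt[k]{\tfrac{\psi^{a,b}_{k}(x)}{2}-\sqrt{\tfrac{(\psi^{a,b}_{k}(x))^2}{4}+b^k}}=\sqrt{a^2x^2+4b}. \]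
   Context: The generalized Lucas polynomials are defined by $\psi^{a,b}_0(x)=2$, $\psi^{a,b}_1(x)=ax$, $\psi^{a,b}_j(x)=ax\,\psi^{a,b}_{j-1}(x)+b\,\psi^{a,b}_{j-2}(x)$ for $j\ge2$. $\sqrt{\cdot}$ denotes the nonnegative square root; for odd $k$, $\sqrt[k]{\cdot}$ denotes the real $k$-th root. *)

theory Defs
  imports Complex_Main "HOL-Computational_Algebra.Polynomial"
begin

fun gen_lucas :: "real \<Rightarrow> real \<Rightarrow> nat \<Rightarrow> real poly" where
  "gen_lucas a b 0 = [:2:]"
| "gen_lucas a b (Suc 0) = [:0, a:]"
| "gen_lucas a b (Suc (Suc j)) =
     [:0, a:] * gen_lucas a b (Suc j) + [:b:] * gen_lucas a b j"

end

theory Submission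
  imports Defs
begin

text \<open>Let \<open>u\<close>, \<open>v\<close> be the roots of t^2 - a x t - b, so
  \<open>u + v = a * x\<close> and \<open>u * v = - b\<close>. The powers of each root satisfy the
  recurrence of \<open>gen_lucas\<close>, and the initial values match, so the polynomial takes the
  value u^n + v^n at x (a Binet formula). For odd k, b^k = -(u v)^k, so the inner radicand is ((u^k
  - v^k)/2)^2. The two k-th roots are then \<open>u\<close> and \<open>v\<close>, whose sum and
  difference are the claimed values.\<close>

lemma poly_gen_lucas_eq_power_sum:
  fixes a b x u v :: real
  assumes sum: "u + v = a * x" and prod: "u * v = - b"
  shows "poly (gen_lucas a b n) x = u ^ n + v ^ n"
proof (induction n rule: induct_nat_012)
  fix j
  have b: "b = - (u * v)" using prod by simp
  assume "poly (gen_lucas a b (Suc j)) x = u ^ Suc j + v ^ Suc j"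
    and "poly (gen_lucas a b j) x = u ^ j + v ^ j"
  then have "poly (gen_lucas a b (Suc (Suc j))) x
      = (u + v) * (u ^ Suc j + v ^ Suc j) - u * v * (u ^ j + v ^ j)"
    using sum b by (simp add: mult.commute)
  also have "\<dots> = u ^ Suc (Suc j) + v ^ Suc (Suc j)"
    by (simp add: algebra_simps)
  finally show "poly (gen_lucas a b (Suc (Suc j))) x = u ^ Suc (Suc j) + v ^ Suc (Suc j)" .
qed (use sum in \<open>simp_all add: mult.commute\<close>)

theorem theorem5:
  fixes a b x :: real and k :: nat
  assumes "a \<noteq> 0" and "b \<noteq> 0"
    and "k > 0" and "odd k"
    and "(a * x)\<^sup>2 \<ge> - 4 * b"
  shows "root k (poly (gen_lucas a b k) x / 2 + sqrt ((poly (gen_lucas a b k) x)\<^sup>2 / 4 + b ^ k))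
       + root k (poly (gen_lucas a b k) x / 2 - sqrt ((poly (gen_lucas a b k) x)\<^sup>2 / 4 + b ^ k))
       = a * x
    \<and> root k (poly (gen_lucas a b k) x / 2 + sqrt ((poly (gen_lucas a b k) x)\<^sup>2 / 4 + b ^ k))
       - root k (poly (gen_lucas a b k) x / 2 - sqrt ((poly (gen_lucas a b k) x)\<^sup>2 / 4 + b ^ k))
       = sqrt (a\<^sup>2 * x\<^sup>2 + 4 * b)"
proof -
  \<comment> \<open>The hypothesis on x says that the discriminant \<open>s\<^sup>2\<close> is
    nonnegative, so both roots are real.\<close>
  define s where "s = sqrt (a\<^sup>2 * x\<^sup>2 + 4 * b)"
  define u where "u = (a * x + s) / 2"
  define v where "v = (a * x - s) / 2"
  let ?p = "poly (gen_lucas a b k) x"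
  have disc: "0 \<le> a\<^sup>2 * x\<^sup>2 + 4 * b"
    using assms(5) by (simp add: power_mult_distrib)
  then have s2: "s\<^sup>2 = a\<^sup>2 * x\<^sup>2 + 4 * b" and s0: "0 \<le> s"
    by (simp_all add: s_def)
  have sum: "u + v = a * x" and diff: "u - v = s"
    by (simp_all add: u_def v_def field_simps)
  have prod: "u * v = - b"
    using s2 by (simp add: u_def v_def field_simps power2_eq_square)
  have p: "?p = u ^ k + v ^ k"
    using sum prod by (rule poly_gen_lucas_eq_power_sum)
  have "b ^ k = (- (u * v)) ^ k"
    using prod by simp
  also have "\<dots> = - (u ^ k * v ^ k)"
    using \<open>odd k\<close> by (simp add: power_mult_distrib)
  finally have "?p\<^sup>2 / 4 + b ^ k = ((u ^ k - v ^ k) / 2)\<^sup>2"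
    by (simp add: p power2_eq_square field_simps)
  \<comment> \<open>This fixes the sign when the square root is taken; odd powers preserve order
    even among negative numbers.\<close>
  moreover have "v ^ k \<le> u ^ k"
    using diff s0 \<open>odd k\<close> by (intro power_mono_odd) auto
  ultimately have sqrt: "sqrt (?p\<^sup>2 / 4 + b ^ k) = (u ^ k - v ^ k) / 2"
    by simp
  have "?p / 2 + sqrt (?p\<^sup>2 / 4 + b ^ k) = u ^ k"
    and "?p / 2 - sqrt (?p\<^sup>2 / 4 + b ^ k) = v ^ k"
    unfolding sqrt by (simp_all add: p field_simps)
  \<comment> \<open>An odd root undoes the k-th power whatever the signs of \<open>u\<close> and
    \<open>v\<close>.\<close>
  then show ?thesis
    using sum diff \<open>odd k\<close> by (simp add: odd_real_root_power_cancel s_def)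
qed

end
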